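(* Let $\omega:[0,\infty)\to[0,\infty)$ be a non-decreasing continuous function such that $\omega(t)=0$ implies $t=0$. Let $f(x,y)$ be a nonnegative continuous function on $[0,\infty)\times[0,\infty)$, and let $0<\alpha\le 1$. Assume that $y:[0,\infty)\to[0,\infty)$ is a continuous function, $$\int_0^\infty \omega(y(t))\frac{1}{(1+t)^\alpha}\,dt<\infty,$$ $$y(t)-y(s)\le\int_s^t f(x,y(x))\,dx,\qquad 0\le s\le t,$$ and there exist constants $a>0$ and $\kappa>0$ such that $$\int_s^t\sup_{0\le\zeta\le a}f(x,\zeta)\,dx\le \kappa a\,\frac{t-s}{s^\alpha}\qquad\text{for all } t>s\gg1 .$$ Then $$\lim_{t\to\infty}y(t)=0.$$
   Context: The notation "for all $t>s\gg1$" means: there exists $S>0$ such that the inequality holds for all $s,t$ with $t>s\ge S$. *)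

theory Defs
  imports "HOL-Analysis.Analysis"
begin

end

theory Submission imports Defs begin

text \<open>
  Write \<open>W s = {s..s + c * s powr \<alpha>}\<close> for the window of relative length \<open>c\<close> at
  \<open>s\<close>.  For \<open>s \<ge> 1\<close> and \<open>\<alpha> \<le> 1\<close> the weight \<open>1 / (1 + t) powr \<alpha>\<close> is comparable to
  \<open>1 / s powr \<alpha>\<close> all over \<open>W s\<close>, so \<open>W s\<close> has weighted measure bounded below by a positive
  constant that does not depend on \<open>s\<close>.  If \<open>y \<ge> \<delta>\<close> held on windows \<open>W s\<close> with \<open>s\<close> arbitrarily
  large, each would contribute at least a fixed multiple of \<open>\<omega> \<delta> > 0\<close> to the convergent
  integral; hence \<open>y\<close> drops below \<open>\<delta>\<close> in every late window (\<open>value_below_in_late_windows\<close>).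

  On the other hand, \<open>y\<close> cannot rise quickly.  Let \<open>\<epsilon> \<le> a\<close>.  If \<open>y\<close> reached \<open>\<epsilon>\<close> at some late
  time, then, having been below \<open>\<epsilon> / 2\<close> in an earlier window, it would climb from \<open>\<epsilon> / 2\<close> to \<open>\<epsilon>\<close>
  over some interval \<open>{u..v}\<close> on which it stays between these values
  (\<open>upcrossing_interval\<close>).  There \<open>f x (y x)\<close> is at most the supremum of \<open>f x\<close> over \<open>{0..a}\<close>,
  and the two integral inequalities give \<open>\<epsilon> / 2 \<le> \<kappa> * a * (v - u) / u powr \<alpha>\<close>.  So \<open>{u..v}\<close>
  contains the window at \<open>u\<close> of relative length \<open>c = \<epsilon> / (2 * \<kappa> * a)\<close>, on which \<open>y \<ge> \<epsilon> / 2\<close>,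
  against the previous paragraph.
\<close>

text \<open>
  By uniform continuity on the compact product, nearby parameters \<open>x\<close> give uniformly close
  functions \<open>f x\<close>, and suprema of uniformly close functions are close.
\<close>

lemma continuous_on_SUP_compact:
  fixes f :: "'a::metric_space \<Rightarrow> 'b::metric_space \<Rightarrow> real"
  assumes "compact A" "compact K" "K \<noteq> {}"
    and cont: "continuous_on (A \<times> K) (\<lambda>(x, z). f x z)"
  shows "continuous_on A (\<lambda>x. SUP z\<in>K. f x z)"
proof -
  have bdd: "bdd_above (f x ` K)" if "x \<in> A" for x
  proof -
    have "continuous_on K (\<lambda>z. (\<lambda>(x, z). f x z) (x, z))"
      by (rule continuous_on_compose2[OF cont]) (use that in \<open>auto intro!: continuous_intros\<close>)
    then have "compact (f x ` K)"
      using compact_continuous_image[OF _ \<open>compact K\<close>] by simp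
    then show ?thesis
      by (simp add: bounded_imp_bdd_above compact_imp_bounded)
  qed
  have unif: "uniformly_continuous_on (A \<times> K) (\<lambda>(x, z). f x z)"
    by (intro compact_uniformly_continuous cont compact_Times assms)
  have "\<exists>d>0. \<forall>x'\<in>A. dist x' x < d \<longrightarrow> dist (SUP z\<in>K. f x' z) (SUP z\<in>K. f x z) < e"
    if "x \<in> A" "0 < e" for x e
  proof -
    have "0 < e / 2" using \<open>0 < e\<close> by simp
    with unif obtain d where "0 < d"
      and d: "\<And>p q. \<lbrakk>p \<in> A \<times> K; q \<in> A \<times> K; dist q p < d\<rbrakk> \<Longrightarrow>
               dist ((\<lambda>(x, z). f x z) q) ((\<lambda>(x, z). f x z) p) < e / 2"
      unfolding uniformly_continuous_on_def by metis
    have le: "(SUP z\<in>K. f x1 z) \<le> (SUP z\<in>K. f x2 z) + e / 2"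
      if "x1 \<in> A" "x2 \<in> A" "dist x1 x2 < d" for x1 x2
    proof (rule cSUP_least[OF \<open>K \<noteq> {}\<close>])
      fix z assume "z \<in> K"
      have "dist (f x1 z) (f x2 z) < e / 2"
        using d[of "(x2, z)" "(x1, z)"] that \<open>z \<in> K\<close> by (simp add: dist_Pair_Pair)
      moreover have "f x2 z \<le> (SUP z\<in>K. f x2 z)"
        by (rule cSUP_upper[OF \<open>z \<in> K\<close> bdd[OF \<open>x2 \<in> A\<close>]])
      ultimately show "f x1 z \<le> (SUP z\<in>K. f x2 z) + e / 2"
        unfolding dist_real_def by linarith
    qed
    have "dist (SUP z\<in>K. f x' z) (SUP z\<in>K. f x z) < e" if "x' \<in> A" "dist x' x < d" for x'
      using le[OF \<open>x' \<in> A\<close> \<open>x \<in> A\<close>] le[OF \<open>x \<in> A\<close> \<open>x' \<in> A\<close>] that \<open>0 < e\<close>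
      by (simp add: dist_real_def dist_commute)
    then show ?thesis using \<open>0 < d\<close> by blast
  qed
  then show ?thesis
    by (simp add: continuous_on_iff)
qed

text \<open>
  Let \<open>v\<close> be the first time at which \<open>h\<close> reaches \<open>q\<close>, and \<open>u\<close> the last time before \<open>v\<close> at which
  it is at most \<open>p\<close>; between them \<open>h\<close> can leave the band \<open>{p..q}\<close> on neither side.
\<close>

lemma upcrossing_interval:
  fixes h :: "real \<Rightarrow> real"
  assumes cont: "continuous_on {s..t} h" and "s \<le> t" "h s \<le> p" "p < q" "q \<le> h t"
  obtains u v where "s \<le> u" "u < v" "v \<le> t" "h u = p" "h v = q"
    "\<And>x. x \<in> {u..v} \<Longrightarrow> h x \<in> {p..q}"
proof -
  define V where "V = {x\<in>{s..t}. q \<le> h x}"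
  have "compact V"
    unfolding V_def
    using continuous_on_closed_Collect_le[OF continuous_on_const cont closed_atLeastAtMost]
    by (auto simp: compact_eq_bounded_closed intro: bounded_subset[OF bounded_closed_interval])
  moreover have "V \<noteq> {}" using assms by (auto simp: V_def)
  ultimately have "\<exists>v\<in>V. \<forall>x\<in>V. v \<le> x" by (rule compact_attains_inf)
  then obtain v where v: "v \<in> V" and v_least: "\<forall>x\<in>V. v \<le> x" by (rule bexE)
  have below_q: "h x < q" if "s \<le> x" "x < v" for x
  proof -
    have "x \<notin> V" using v_least that by auto
    then show ?thesis using that v by (simp add: V_def)
  qed
  have cont_v: "continuous_on {s..v} h"
    by (rule continuous_on_subset[OF cont]) (use v in \<open>auto simp: V_def\<close>)
  obtain x where "s \<le> x" "x \<le> v" "h x = q"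
    using IVT'[of h s q v] cont_v v assms by (auto simp: V_def)
  then have hv: "h v = q" using below_q[of x] by fastforce
  define U where "U = {x\<in>{s..v}. h x \<le> p}"
  have "compact U"
    unfolding U_def
    using continuous_on_closed_Collect_le[OF cont_v continuous_on_const closed_atLeastAtMost]
    by (auto simp: compact_eq_bounded_closed intro: bounded_subset[OF bounded_closed_interval])
  moreover have "U \<noteq> {}" using assms v by (auto simp: U_def V_def)
  ultimately have "\<exists>u\<in>U. \<forall>x\<in>U. x \<le> u" by (rule compact_attains_sup)
  then obtain u where u: "u \<in> U" and u_greatest: "\<forall>x\<in>U. x \<le> u" by (rule bexE)
  have above_p: "p < h x" if "u < x" "x \<le> v" for x
  proof -
    have "x \<notin> U" using u_greatest that by auto
    then show ?thesis using that u by (simp add: U_def)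
  qed
  have "continuous_on {u..v} h"
    by (rule continuous_on_subset[OF cont_v]) (use u in \<open>auto simp: U_def\<close>)
  then obtain x where "u \<le> x" "x \<le> v" "h x = p"
    using IVT'[of h u p v] u hv \<open>p < q\<close> by (auto simp: U_def)
  then have hu: "h u = p" using above_p[of x] by fastforce
  show ?thesis
  proof (rule that)
    show "s \<le> u" "v \<le> t" using u v by (auto simp: U_def V_def)
    show "u < v" using u hu hv \<open>p < q\<close> by (cases "u = v") (auto simp: U_def)
    show "h x \<in> {p..q}" if "x \<in> {u..v}" for x
      using above_p[of x] below_q[of x] hu hv that u \<open>p < q\<close>
      by (cases "x = u"; cases "x = v") (auto simp: U_def)
  qed (fact hu hv)+
qed

text \<open>
  The integrals over \<open>{b..t}\<close> increase with \<open>t\<close> and stay bounded, so beyond a point where they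
  come within \<open>e\<close> of their supremum they gain less than \<open>e\<close>.
\<close>

lemma integral_tail_less:
  fixes g :: "real \<Rightarrow> real"
  assumes int: "g integrable_on {b..}" and nonneg: "\<And>x. b \<le> x \<Longrightarrow> 0 \<le> g x" and "0 < e"
  obtains S where "b \<le> S" "\<And>s t. \<lbrakk>S \<le> s; s \<le> t\<rbrakk> \<Longrightarrow> integral {s..t} g < e"
proof -
  define G where "G t = integral {b..t} g" for t
  have int': "g integrable_on {s..t}" if "b \<le> s" for s t
    by (rule integrable_on_subinterval[OF int]) (use that in auto)
  have split: "G t = G s + integral {s..t} g" if "b \<le> s" "s \<le> t" for s t
    unfolding G_def using that by (simp add: Henstock_Kurzweil_Integration.integral_combine int')
  have mono: "G s \<le> G t" if "b \<le> s" "s \<le> t" for s t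
    using split[OF that] integral_nonneg[OF int'[OF that(1)], of t] nonneg that by auto
  have "G t \<le> integral {b..} g" if "b \<le> t" for t
    unfolding G_def by (rule integral_subset_le) (use that int int' nonneg in auto)
  then have bdd: "bdd_above (G ` {b..})"
    by (auto intro!: bdd_aboveI2)
  obtain S where S: "b \<le> S" "(SUP t\<in>{b..}. G t) - e < G S"
    using less_cSUP_iff[OF _ bdd, of "(SUP t\<in>{b..}. G t) - e"] \<open>0 < e\<close> by auto
  show ?thesis
  proof (rule that[OF \<open>b \<le> S\<close>])
    fix s t assume st: "S \<le> s" "s \<le> t"
    have "G t \<le> (SUP t\<in>{b..}. G t)"
      by (rule cSUP_upper[OF _ bdd]) (use st S in auto)
    with S split[of s t] mono[of S s] st show "integral {s..t} g < e" by auto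
  qed
qed

text \<open>
  For \<open>1 \<le> s\<close> and \<open>x\<close> in the window, \<open>1 + x \<le> (2 + c) * s\<close> because \<open>s powr \<alpha> \<le> s\<close>.  If \<open>y\<close> were at
  least \<open>\<delta>\<close> throughout, the window of length \<open>c * s powr \<alpha>\<close> would therefore carry an integral of
  at least \<open>\<omega> \<delta> * c / (2 + c) powr \<alpha>\<close>, which is positive and independent of \<open>s\<close>.
\<close>

lemma value_below_in_late_windows:
  fixes \<omega> y :: "real \<Rightarrow> real"
  assumes \<omega>_nonneg: "\<And>t. 0 \<le> t \<Longrightarrow> 0 \<le> \<omega> t"
    and \<omega>_mono: "mono_on {0..} \<omega>"
    and \<alpha>: "0 \<le> \<alpha>" "\<alpha> \<le> 1"
    and y_nonneg: "\<And>t. 0 \<le> t \<Longrightarrow> 0 \<le> y t"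
    and int: "(\<lambda>t. \<omega> (y t) * (1 / (1 + t) powr \<alpha>)) integrable_on {0..}"
    and "0 \<le> \<delta>" "0 < \<omega> \<delta>" "0 < c"
  obtains S where "\<And>s. S \<le> s \<Longrightarrow> \<exists>x\<in>{s..s + c * s powr \<alpha>}. y x < \<delta>"
proof -
  define g where "g t = \<omega> (y t) * (1 / (1 + t) powr \<alpha>)" for t
  define e where "e = \<omega> \<delta> * c / (2 + c) powr \<alpha>"
  have "0 < e" using assms by (simp add: e_def)
  have int': "g integrable_on {0..}" using int unfolding g_def .
  moreover have "0 \<le> g x" if "0 \<le> x" for x
    using \<omega>_nonneg y_nonneg that by (simp add: g_def)
  ultimately obtain S where S: "0 \<le> S" "\<And>s t. \<lbrakk>S \<le> s; s \<le> t\<rbrakk> \<Longrightarrow> integral {s..t} g < e"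
    using integral_tail_less \<open>0 < e\<close> by blast
  show ?thesis
  proof (rule that)
    fix s assume s: "max S 1 \<le> s"
    then have "0 < s" "1 \<le> s" "S \<le> s" by auto
    define t where "t = s + c * s powr \<alpha>"
    have "s \<le> t" using \<open>0 < c\<close> by (simp add: t_def)
    have "s powr \<alpha> \<le> s"
      using powr_mono[OF \<alpha>(2) \<open>1 \<le> s\<close>] \<open>0 < s\<close> by simp
    then have "t \<le> s + c * s" using \<open>0 < c\<close> by (simp add: t_def)
    show "\<exists>x\<in>{s..s + c * s powr \<alpha>}. y x < \<delta>"
    proof (rule ccontr)
      assume "\<not> ?thesis"
      then have large: "\<delta> \<le> y x" if "x \<in> {s..t}" for x
        using that unfolding t_def by force
      define m where "m = \<omega> \<delta> * (1 / ((2 + c) * s) powr \<alpha>)"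
      have "m \<le> g x" if x: "x \<in> {s..t}" for x
      proof -
        have "\<omega> \<delta> \<le> \<omega> (y x)"
          using mono_onD[OF \<omega>_mono, of \<delta> "y x"] large[OF x] \<open>0 \<le> \<delta>\<close> by auto
        moreover have "(1 + x) powr \<alpha> \<le> ((2 + c) * s) powr \<alpha>"
          using x \<open>t \<le> s + c * s\<close> \<open>1 \<le> s\<close> \<alpha> by (intro powr_mono2) (auto simp: algebra_simps)
        then have "1 / ((2 + c) * s) powr \<alpha> \<le> 1 / (1 + x) powr \<alpha>"
          using x \<open>0 < s\<close> \<open>0 < c\<close> by (intro divide_left_mono mult_pos_pos) auto
        ultimately show ?thesis
          unfolding m_def g_def using \<open>0 < \<omega> \<delta>\<close> by (intro mult_mono) auto
      qed
      then have "integral {s..t} (\<lambda>_. m) \<le> integral {s..t} g"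
        using \<open>0 < s\<close> by (intro integral_le integrable_on_subinterval[OF int']) auto
      moreover have "integral {s..t} (\<lambda>_. m) = e"
        using \<open>s \<le> t\<close> \<open>0 < s\<close> \<open>0 < c\<close> by (simp add: m_def e_def t_def powr_mult)
      ultimately show False using S(2)[OF \<open>S \<le> s\<close> \<open>s \<le> t\<close>] by simp
    qed
  qed
qed

theorem theorem2p7:
  fixes \<omega> y :: "real \<Rightarrow> real"
    and f :: "real \<Rightarrow> real \<Rightarrow> real"
    and \<alpha> a \<kappa> :: real
  assumes \<omega>_nonneg: "\<And>t. 0 \<le> t \<Longrightarrow> 0 \<le> \<omega> t"
    and \<omega>_mono: "mono_on {0..} \<omega>"
    and \<omega>_cont: "continuous_on {0..} \<omega>"
    and \<omega>_zero: "\<And>t. 0 \<le> t \<Longrightarrow> \<omega> t = 0 \<Longrightarrow> t = 0"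
    and f_cont: "continuous_on ({0..} \<times> {0..}) (\<lambda>(x, \<zeta>). f x \<zeta>)"
    and f_nonneg: "\<And>x \<zeta>. 0 \<le> x \<Longrightarrow> 0 \<le> \<zeta> \<Longrightarrow> 0 \<le> f x \<zeta>"
    and \<alpha>: "0 < \<alpha>" "\<alpha> \<le> 1"
    and y_nonneg: "\<And>t. 0 \<le> t \<Longrightarrow> 0 \<le> y t"
    and y_cont: "continuous_on {0..} y"
    and y_int: "(\<lambda>t. \<omega> (y t) * (1 / (1 + t) powr \<alpha>)) integrable_on {0..}"
    and y_incr: "\<And>s t. 0 \<le> s \<Longrightarrow> s \<le> t \<Longrightarrow> y t - y s \<le> integral {s..t} (\<lambda>x. f x (y x))"
    and a: "0 < a"
    and \<kappa>: "0 < \<kappa>"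
    and f_sup: "\<exists>S>0. \<forall>s t. S \<le> s \<and> s < t \<longrightarrow>
      integral {s..t} (\<lambda>x. SUP \<zeta>\<in>{0..a}. f x \<zeta>) \<le> \<kappa> * a * ((t - s) / s powr \<alpha>)"
  shows "(y \<longlongrightarrow> 0) at_top"
proof -
  obtain S0 where "0 < S0"
    and S0: "\<And>s t. \<lbrakk>S0 \<le> s; s < t\<rbrakk> \<Longrightarrow>
      integral {s..t} (\<lambda>x. SUP \<zeta>\<in>{0..a}. f x \<zeta>) \<le> \<kappa> * a * ((t - s) / s powr \<alpha>)"
    using f_sup by blast
  have small: "\<exists>T. \<forall>t\<ge>T. y t < \<epsilon>" if "0 < \<epsilon>" "\<epsilon> \<le> a" for \<epsilon>
  proof -
    define c where "c = \<epsilon> / (2 * \<kappa> * a)"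
    have "0 < c" using \<open>0 < \<epsilon>\<close> a \<kappa> by (simp add: c_def)
    have half: "0 \<le> \<epsilon> / 2" using \<open>0 < \<epsilon>\<close> by simp
    then have "0 < \<omega> (\<epsilon> / 2)"
      using \<omega>_nonneg[of "\<epsilon> / 2"] \<omega>_zero[of "\<epsilon> / 2"] \<open>0 < \<epsilon>\<close> by fastforce
    from value_below_in_late_windows[OF \<omega>_nonneg \<omega>_mono less_imp_le[OF \<alpha>(1)] \<alpha>(2)
        y_nonneg y_int half this \<open>0 < c\<close>]
    obtain S1 where S1: "\<And>s. S1 \<le> s \<Longrightarrow> \<exists>x\<in>{s..s + c * s powr \<alpha>}. y x < \<epsilon> / 2"
      by blast
    define S where "S = max S0 S1"
    have "0 < S" "S0 \<le> S" "S1 \<le> S" using \<open>0 < S0\<close> by (auto simp: S_def)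
    obtain s where s: "S \<le> s" "s \<le> S + c * S powr \<alpha>" "y s < \<epsilon> / 2"
      using S1[OF \<open>S1 \<le> S\<close>] by auto
    have "y t < \<epsilon>" if "S + c * S powr \<alpha> \<le> t" for t
    proof (rule ccontr)
      assume "\<not> y t < \<epsilon>"
      moreover have "s \<le> t" using s that by simp
      moreover have "continuous_on {s..t} y"
        by (rule continuous_on_subset[OF y_cont]) (use s \<open>0 < S\<close> in auto)
      ultimately obtain u v where uv: "s \<le> u" "u < v" "v \<le> t" "y u = \<epsilon> / 2" "y v = \<epsilon>"
        and band: "\<And>x. x \<in> {u..v} \<Longrightarrow> y x \<in> {\<epsilon> / 2..\<epsilon>}"
        using upcrossing_interval[of s t y "\<epsilon> / 2" \<epsilon>] s \<open>0 < \<epsilon>\<close> by auto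
      have "S \<le> u" "0 < u" using s uv \<open>0 < S\<close> by auto
      have f_cont': "continuous_on ({u..v} \<times> {0..a}) (\<lambda>(x, \<zeta>). f x \<zeta>)"
        by (rule continuous_on_subset[OF f_cont]) (use \<open>0 < u\<close> in auto)
      have y_band: "y x \<in> {0..a}" if "x \<in> {u..v}" for x
        using band[OF that] \<open>0 < \<epsilon>\<close> \<open>\<epsilon> \<le> a\<close> by auto
      have sup_int: "(\<lambda>x. SUP \<zeta>\<in>{0..a}. f x \<zeta>) integrable_on {u..v}"
        by (intro integrable_continuous_real continuous_on_SUP_compact f_cont') (use a in auto)
      have "continuous_on {u..v} y"
        by (rule continuous_on_subset[OF y_cont]) (use \<open>0 < u\<close> in auto)
      then have "continuous_on {u..v} (\<lambda>x. (\<lambda>(x, \<zeta>). f x \<zeta>) (x, y x))"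
        by (intro continuous_on_compose2[OF f_cont'] continuous_intros) (use y_band in auto)
      then have fy_int: "(\<lambda>x. f x (y x)) integrable_on {u..v}"
        by (simp add: integrable_continuous_real)
      have le_SUP: "f x (y x) \<le> (SUP \<zeta>\<in>{0..a}. f x \<zeta>)" if x: "x \<in> {u..v}" for x
      proof (rule cSUP_upper[OF y_band[OF x]])
        have "continuous_on {0..a} (\<lambda>\<zeta>. (\<lambda>(x, \<zeta>). f x \<zeta>) (x, \<zeta>))"
          by (intro continuous_on_compose2[OF f_cont'] continuous_intros) (use x in auto)
        then show "bdd_above (f x ` {0..a})"
          using compact_continuous_image[of "{0..a}" "f x"]
          by (simp add: bounded_imp_bdd_above compact_imp_bounded)
      qed
      have "\<epsilon> / 2 = y v - y u" using uv by simp
      also have "\<dots> \<le> integral {u..v} (\<lambda>x. f x (y x))"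
        by (rule y_incr) (use \<open>0 < u\<close> uv in auto)
      also have "\<dots> \<le> integral {u..v} (\<lambda>x. SUP \<zeta>\<in>{0..a}. f x \<zeta>)"
        by (rule integral_le[OF fy_int sup_int le_SUP])
      also have "\<dots> \<le> \<kappa> * a * ((v - u) / u powr \<alpha>)"
        using S0 \<open>S0 \<le> S\<close> \<open>S \<le> u\<close> uv by simp
      finally have "c * u powr \<alpha> \<le> v - u"
        using a \<kappa> \<open>0 < u\<close> by (simp add: c_def field_simps)
      then have "\<epsilon> / 2 \<le> y x" if "x \<in> {u..u + c * u powr \<alpha>}" for x
        using band[of x] that by auto
      then show False using S1[of u] \<open>S1 \<le> S\<close> \<open>S \<le> u\<close> by force
    qed
    then show ?thesis by blast
  qed
  show ?thesis
  proof (rule tendstoI)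
    fix e :: real assume "0 < e"
    then obtain T where T: "\<And>t. T \<le> t \<Longrightarrow> y t < min e a"
      using small[of "min e a"] a by auto
    show "\<forall>\<^sub>F t in at_top. dist (y t) 0 < e"
      unfolding eventually_at_top_linorder
    proof (intro exI[of _ "max 0 T"] allI impI)
      fix t assume "max 0 T \<le> t"
      then show "dist (y t) 0 < e" using T[of t] y_nonneg[of t] by simp
    qed
  qed
qed

end
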